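(* Let $d,m\colon\mathbb{N}\to\mathbb{N}$ be polynomially bounded functions. Then there exists $n_0$ such that for all $n\ge n_0$ the search problem $\mathrm{NestedCollision}_n$ admits no depth-$d(n)$ $\mathrm{Collision}_{m(n)}$-formulation.
   Context: Conventions: $\{0,1\}^{kn}$ is identified with $(\{0,1\}^n)^k$ blockwise; $n,m\ge 1$ throughout so that $\{0,1\}^{n-1}$ and $\{0,1\}^{m-1}$ make sense. $\mathrm{NestedCollision}_n$: an instance is a pair $(f,g)$ of arbitrary functions (given as full truth tables) $f\colon\{0,1\}^n\to\{0,1\}^{n-1}$ and $g\colon\{0,1\}^{2n}\times\{0,1\}^n\to\{0,1\}^{n-1}$. A solution is a tuple $(x,y,u,v)\in(\{0,1\}^n)^4$ such that $x\ne y$, $f(x)=f(y)$, $u\ne v$, and $g(x,y,u)=g(x,y,v)$. Decision trees: a decision tree over instances $(f,g)$ is a rooted tree in which each internal node is labeled by a query to a single truth-table entry, either $f(x)$ for some $x\in\{0,1\}^n$ or $g(x,y,u)$ for some $(x,y,u)\in(\{0,1\}^n)^3$, and has one child for each possible answer in $\{0,1\}^{n-1}$; each leaf is labeled by an output. On $(f,g)$, it follows the root-to-leaf path determined by the answers and returns the leaf's output. The depth is the maximum number of queries on a root-to-leaf path. A depth-$d$ $\mathrm{Collision}_m$-formulation of $\mathrm{NestedCollision}_n$ consists of two families of decision trees $(T_w)_{w\in\{0,1\}^m}$ and $(D_{w_1,w_2})_{w_1\neq w_2\in\{0,1\}^m}$ over instances $(f,g)$ such that: (Forward part) each $T_w$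 has depth at most $d$ and on $(f,g)$ outputs a value $C^{f,g}(w)\in\{0,1\}^{m-1}$; (Backward part) each $D_{w_1,w_2}$ has depth at most $d$ and on $(f,g)$ outputs a tuple in $(\{0,1\}^n)^4$; (Correctness) for every instance $(f,g)$ and every pair $w_1\ne w_2\in\{0,1\}^m$, if $C^{f,g}(w_1)=C^{f,g}(w_2)$, then $D_{w_1,w_2}(f,g)$ is a solution to the $\mathrm{NestedCollision}_n$ instance $(f,g)$. *)

theory Defs
  imports "HOL-Computational_Algebra.Polynomial" "HOL-Library.FuncSet"
begin

definition bits :: "nat \<Rightarrow> bool list set" where
  "bits n = {w. length w = n}"

definition polynomially_bounded :: "(nat \<Rightarrow> nat) \<Rightarrow> bool" where
  "polynomially_bounded h \<longleftrightarrow> (\<exists>p :: nat poly. \<forall>n. h n \<le> poly p n)"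

type_synonym fun_f = "bool list \<Rightarrow> bool list"
type_synonym fun_g = "bool list \<times> bool list \<times> bool list \<Rightarrow> bool list"
type_synonym quadruple = "bool list \<times> bool list \<times> bool list \<times> bool list"

text \<open>The first argument of \<open>g\<close>, a string of length \<open>2 * n\<close>, is kept as its two blocks of
  length \<open>n\<close>. Extensional functions represent truth tables uniquely. As \<open>n - 1\<close> is truncated
  subtraction, these notions are meant for \<open>n \<ge> 1\<close> (and \<open>m \<ge> 1\<close> below).\<close>

definition nested_collision_instances :: "nat \<Rightarrow> (fun_f \<times> fun_g) set" where
  "nested_collision_instances n =
     (bits n \<rightarrow>\<^sub>E bits (n - 1)) \<times> (bits n \<times> bits n \<times> bits n \<rightarrow>\<^sub>E bits (n - 1))"

fun nested_collision_solution :: "nat \<Rightarrow> fun_f \<times> fun_g \<Rightarrow> quadruple \<Rightarrow> bool" where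
  "nested_collision_solution n (f, g) (x, y, u, v) \<longleftrightarrow>
     x \<in> bits n \<and> y \<in> bits n \<and> u \<in> bits n \<and> v \<in> bits n \<and>
     x \<noteq> y \<and> f x = f y \<and> u \<noteq> v \<and> g (x, y, u) = g (x, y, v)"

datatype query = QueryF "bool list" | QueryG "bool list \<times> bool list \<times> bool list"

fun valid_query :: "nat \<Rightarrow> query \<Rightarrow> bool" where
  "valid_query n (QueryF x) \<longleftrightarrow> x \<in> bits n"
| "valid_query n (QueryG z) \<longleftrightarrow> z \<in> bits n \<times> bits n \<times> bits n"

fun answer :: "fun_f \<times> fun_g \<Rightarrow> query \<Rightarrow> bool list" where
  "answer (f, g) (QueryF x) = f x"
| "answer (f, g) (QueryG z) = g z"

text \<open>The children of an internal node are given as a function on all bit strings; only its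
  values on \<open>bits (n - 1)\<close> count as children, the others are ignored by well-formedness and
  depth and are never reached on an instance.\<close>

datatype 'o dtree = Leaf 'o | Node query "bool list \<Rightarrow> 'o dtree"

primrec decision_tree :: "nat \<Rightarrow> 'o set \<Rightarrow> 'o dtree \<Rightarrow> bool" where
  "decision_tree n Out (Leaf z) \<longleftrightarrow> z \<in> Out"
| "decision_tree n Out (Node q c) \<longleftrightarrow>
     valid_query n q \<and> (\<forall>a \<in> bits (n - 1). decision_tree n Out (c a))"

primrec depth :: "nat \<Rightarrow> 'o dtree \<Rightarrow> nat" where
  "depth n (Leaf z) = 0"
| "depth n (Node q c) = Suc (Max ((\<lambda>a. depth n (c a)) ` bits (n - 1)))"

primrec run :: "fun_f \<times> fun_g \<Rightarrow> 'o dtree \<Rightarrow> 'o" where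
  "run I (Leaf z) = z"
| "run I (Node q c) = run I (c (answer I q))"

definition collision_formulation ::
  "nat \<Rightarrow> nat \<Rightarrow> nat \<Rightarrow> (bool list \<Rightarrow> bool list dtree) \<Rightarrow>
   (bool list \<Rightarrow> bool list \<Rightarrow> quadruple dtree) \<Rightarrow> bool" where
  "collision_formulation d m n T D \<longleftrightarrow>
     (\<forall>w \<in> bits m. decision_tree n (bits (m - 1)) (T w) \<and> depth n (T w) \<le> d) \<and>
     (\<forall>w1 \<in> bits m. \<forall>w2 \<in> bits m. w1 \<noteq> w2 \<longrightarrow>
        decision_tree n (bits n \<times> bits n \<times> bits n \<times> bits n) (D w1 w2) \<and>
        depth n (D w1 w2) \<le> d) \<and>
     (\<forall>I \<in> nested_collision_instances n. \<forall>w1 \<in> bits m. \<forall>w2 \<in> bits m.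
        w1 \<noteq> w2 \<longrightarrow> run I (T w1) = run I (T w2) \<longrightarrow>
        nested_collision_solution n I (run I (D w1 w2)))"

end

theory Submission
  imports Defs "HOL-Real_Asymp.Real_Asymp"
begin

text \<open>Fix any \<open>g\<close> and draw \<open>f\<close> at random. Say that a tree probes \<open>(f, g)\<close> if it queries some
  \<open>g (x, y, u)\<close> with \<open>x \<noteq> y\<close> and \<open>f x = f y\<close>, whether or not it has queried \<open>f x\<close> and \<open>f y\<close>.
  By lazy sampling, a tree of depth \<open>d\<close> probes with probability at most \<open>4 d\<^sup>2 / 2\<^bsup>n-1\<^esup>\<close>.
  Hence for some \<open>f\<close> more than half of the trees \<open>T w\<close> do not probe, and by the pigeonhole
  principle two of these, for \<open>w1 \<noteq> w2\<close>, have the same output. This remains so when \<open>g\<close> is changed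
  arbitrarily at the entries \<open>(x, y, u)\<close> over collisions \<open>(x, y)\<close> of \<open>f\<close>, so an adversary can
  answer the queries of \<open>D w1 w2\<close> to these entries by pairwise distinct values and thus make its
  output wrong.\<close>

section \<open>Counting bit strings and the depth of subtrees\<close>

lemma finite_bits [simp]: "finite (bits n)"
  and card_bits [simp]: "card (bits n) = 2 ^ n"
  using finite_lists_length_eq[of "UNIV :: bool set" n] card_lists_length_eq[of "UNIV :: bool set" n]
  by (simp_all add: bits_def)

lemma bits_nonempty [simp]: "bits n \<noteq> {}"
  by (metis card.empty card_bits power_not_zero zero_neq_numeral)

lemma ex_bits_notin:
  assumes "finite A" "card A < 2 ^ n"
  shows "\<exists>a \<in> bits n. a \<notin> A"
  by (metis assms card_bits card_mono not_le subsetI)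

lemma depth_child_le:
  assumes "depth n (Node q c) \<le> k" "a \<in> bits (n - 1)"
  shows "Suc (depth n (c a)) \<le> k"
proof -
  have "depth n (c a) \<le> Max ((\<lambda>a. depth n (c a)) ` bits (n - 1))"
    using assms(2) by (intro Max_ge) auto
  then show ?thesis using assms(1) by simp
qed

subsection \<open>Probing a collision\<close>

fun collision_query :: "fun_f \<Rightarrow> query \<Rightarrow> bool" where
  "collision_query f (QueryF x) \<longleftrightarrow> False"
| "collision_query f (QueryG (x, y, u)) \<longleftrightarrow> x \<noteq> y \<and> f x = f y"

primrec probes :: "fun_f \<times> fun_g \<Rightarrow> 'o dtree \<Rightarrow> bool" where
  "probes I (Leaf z) \<longleftrightarrow> False"
| "probes I (Node q c) \<longleftrightarrow> collision_query (fst I) q \<or> probes I (c (answer I q))"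

text \<open>Every entry read on the path for \<open>(f, g)\<close> has the same value in
  \<open>g'\<close>, so both runs follow one path.\<close>

lemma run_cong_not_probes:
  assumes "\<not> probes (f, g) T"
    and "\<And>z. \<not> collision_query f (QueryG z) \<Longrightarrow> g' z = g z"
  shows "run (f, g') T = run (f, g) T"
  using assms(1)
proof (induction T)
  case (Node q c)
  then have "answer (f, g') q = answer (f, g) q"
    using assms(2) by (cases q) auto
  with Node show ?case by auto
qed simp

subsection \<open>Lazy sampling\<close>

text \<open>The sample space left once the values of \<open>f\<close> on \<open>S\<close> are
  revealed; probabilities are expressed as ratios of cardinalities of such sets.\<close>

definition extensions :: "nat \<Rightarrow> bool list set \<Rightarrow> fun_f \<Rightarrow> fun_f set" where
  "extensions n S p = (\<Pi>\<^sub>E x \<in> bits n. if x \<in> S then {p x} else bits (n - 1))"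

lemma finite_extensions [simp]: "finite (extensions n S p)"
  unfolding extensions_def by (intro finite_PiE) auto

text \<open>Each point outside the revealed set contributes a factor \<open>2 ^ (n - 1)\<close> and
  each revealed point a factor 1, whatever its value; hence \<open>p'\<close> may be unrelated to
  \<open>p\<close>.\<close>

lemma card_extensions_insert:
  assumes "x \<in> bits n" "x \<notin> S"
  shows "card (extensions n S p) = 2 ^ (n - 1) * card (extensions n (insert x S) p')"
proof -
  have "card (extensions n S p) = (\<Prod>y \<in> bits n. if y \<in> S then 1 else 2 ^ (n - 1))"
    by (auto simp: extensions_def card_PiE intro!: prod.cong)
  also have "\<dots> = 2 ^ (n - 1) * (\<Prod>y \<in> bits n - {x}. if y \<in> S then 1 else 2 ^ (n - 1))"
    using assms by (simp add: prod.remove)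
  also have "(\<Prod>y \<in> bits n - {x}. if y \<in> S then 1 else 2 ^ (n - 1)) =
      (\<Prod>y \<in> bits n - {x}. card (if y \<in> insert x S then {p' y} else bits (n - 1)))"
    by (intro prod.cong) auto
  also have "\<dots> = card (extensions n (insert x S) p')"
    using assms by (simp add: extensions_def card_PiE prod.remove[of "bits n" x])
  finally show ?thesis .
qed

lemma extensions_split:
  assumes "x \<in> bits n" "x \<notin> S"
  shows "extensions n S p = (\<Union>a \<in> bits (n - 1). extensions n (insert x S) (p(x := a)))"
proof (intro set_eqI iffI)
  fix f assume f: "f \<in> extensions n S p"
  then have "f x \<in> bits (n - 1)"
    using assms by (auto simp: extensions_def PiE_iff split: if_splits)
  moreover from f have "f \<in> extensions n (insert x S) (p(x := f x))"
    using assms by (auto simp: extensions_def PiE_iff split: if_splits)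
  ultimately show "f \<in> (\<Union>a \<in> bits (n - 1). extensions n (insert x S) (p(x := a)))"
    by blast
next
  fix f assume "f \<in> (\<Union>a \<in> bits (n - 1). extensions n (insert x S) (p(x := a)))"
  then show "f \<in> extensions n S p"
    using assms by (fastforce simp: extensions_def PiE_iff split: if_splits)
qed

lemma extensions_apply:
  assumes "f \<in> extensions n S p" "S \<subseteq> bits n" "x \<in> S"
  shows "f x = p x"
proof -
  have "f x \<in> (if x \<in> S then {p x} else bits (n - 1))"
    using assms(1) unfolding extensions_def by (rule PiE_mem) (use assms(2,3) in auto)
  then show ?thesis using assms(3) by simp
qed

text \<open>If the sampled value at \<open>x\<close> is one of the \<open>card S\<close> known values, \<open>Q\<close> is given up as lost.\<close>

lemma lazy_sample:
  assumes x: "x \<in> bits n" and S: "S \<subseteq> bits n" and p: "inj_on p S" "p ` S \<subseteq> bits (n - 1)"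
    and q: "card S \<le> q"
    and step: "\<And>p'. inj_on p' (insert x S) \<Longrightarrow> p' ` insert x S \<subseteq> bits (n - 1) \<Longrightarrow>
      2 ^ (n - 1) * card {f \<in> extensions n (insert x S) p'. Q f}
        \<le> c * card (extensions n (insert x S) p')"
  shows "2 ^ (n - 1) * card {f \<in> extensions n S p. Q f} \<le> (c + q) * card (extensions n S p)"
proof (cases "x \<in> S")
  case True
  then show ?thesis
    using step[of p] p by (simp add: insert_absorb trans_le_add1 add_mult_distrib)
next
  case False
  define B :: nat where "B = 2 ^ (n - 1)"
  define E where "E = (\<lambda>a. extensions n (insert x S) (p(x := a)))"
  \<comment> \<open>\<open>undefined\<close> is an arbitrary choice of answer: all sets
    \<open>E a\<close> have the same size.\<close>
  define K where "K = card (E undefined)"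
  have "B * K = B * card (E a)" for a
    using card_extensions_insert[OF x False, of p] by (metis B_def E_def K_def)
  then have K: "card (E a) = K" for a
    by (simp add: B_def)
  have fin: "finite S" using S finite_bits by (rule finite_subset)
  have "{f \<in> extensions n S p. Q f} = (\<Union>a \<in> bits (n - 1). {f \<in> E a. Q f})"
    using extensions_split[OF x False] by (auto simp: E_def)
  then have "card {f \<in> extensions n S p. Q f} \<le> (\<Sum>a \<in> bits (n - 1). card {f \<in> E a. Q f})"
    using card_UN_le[OF finite_bits] by simp
  then have "B * card {f \<in> extensions n S p. Q f}
      \<le> (\<Sum>a \<in> bits (n - 1). B * card {f \<in> E a. Q f})"
    unfolding sum_distrib_left[symmetric] by (rule mult_le_mono2)
  \<comment> \<open>A value already taken on \<open>S\<close> gets the trivial bound; a fresh one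
    keeps the revealed part injective, so \<open>step\<close> applies.\<close>
  also have "\<dots> \<le> (\<Sum>a \<in> bits (n - 1). c * K + (if a \<in> p ` S then B * K else 0))"
  proof (rule sum_mono)
    fix a assume a: "a \<in> bits (n - 1)"
    show "B * card {f \<in> E a. Q f} \<le> c * K + (if a \<in> p ` S then B * K else 0)"
    proof (cases "a \<in> p ` S")
      case True
      have "card {f \<in> E a. Q f} \<le> card (E a)"
        by (rule card_mono) (auto simp: E_def)
      then show ?thesis using True by (simp add: K trans_le_add2)
    next
      case Fa: False
      have "inj_on (p(x := a)) (insert x S)"
        using p(1) Fa False by (auto simp: inj_on_def)
      moreover have "(p(x := a)) ` insert x S \<subseteq> bits (n - 1)"
        using p(2) a by auto
      ultimately show ?thesis
        using step[of "p(x := a)"] Fa by (simp add: K[of a, symmetric] E_def B_def)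
    qed
  qed
  also have "\<dots> = B * (c * K) + card (p ` S) * (B * K)"
    using p(2) by (simp add: sum.distrib B_def sum.If_cases Int_absorb1)
  also have "\<dots> \<le> B * (c * K) + q * (B * K)"
    using card_image_le[OF fin, of p] q by (meson add_le_mono le_refl le_trans mult_le_mono1)
  also have "\<dots> = (c + q) * (B * K)" by (simp add: algebra_simps)
  also have "B * K = card (extensions n S p)"
    using card_extensions_insert[OF x False, of p "p(x := undefined)"]
    by (simp add: B_def K_def E_def)
  finally show ?thesis by (simp add: B_def)
qed

text \<open>To decide whether a query \<open>g (x, y, u)\<close> is a probe one samples \<open>f x\<close> and \<open>f y\<close>, hence the
  factor 2.\<close>

lemma card_probes_extensions:
  assumes g: "g \<in> bits n \<times> bits n \<times> bits n \<rightarrow>\<^sub>E bits (n - 1)"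
  shows "decision_tree n Out T \<Longrightarrow> depth n T \<le> k \<Longrightarrow> S \<subseteq> bits n \<Longrightarrow> inj_on p S \<Longrightarrow>
    p ` S \<subseteq> bits (n - 1) \<Longrightarrow> card S + 2 * k \<le> q \<Longrightarrow>
    2 ^ (n - 1) * card {f \<in> extensions n S p. probes (f, g) T}
      \<le> 2 * k * q * card (extensions n S p)"
proof (induction T arbitrary: k S p)
  case (Leaf z)
  then show ?case by simp
next
  case (Node r c)
  then obtain k' where k: "k = Suc k'" by (cases k) auto
  have child: "depth n (c a) \<le> k'" "decision_tree n Out (c a)" if "a \<in> bits (n - 1)" for a
    using depth_child_le[OF Node.prems(2) that] Node.prems(1) that by (auto simp: k)
  have fin: "finite S" using Node.prems(3) finite_bits by (rule finite_subset)
  \<comment> \<open>A query reveals at most two new values, so \<open>card S + 2 * k\<close> does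
    not grow towards the leaves and \<open>q\<close> bounds the number of known values throughout.
    Each level then adds at most \<open>2 * q\<close> to the factor.\<close>
  show ?case
  proof (cases r)
    case (QueryF x)
    then have x: "x \<in> bits n" using Node.prems(1) by simp
    have "2 ^ (n - 1) * card {f \<in> extensions n S p. probes (f, g) (Node r c)}
      \<le> (2 * k' * q + q) * card (extensions n S p)"
    proof (rule lazy_sample[OF x Node.prems(3-5)])
      fix p' assume p': "inj_on p' (insert x S)" "p' ` insert x S \<subseteq> bits (n - 1)"
      let ?E = "extensions n (insert x S) p'"
      have "{f \<in> ?E. probes (f, g) (Node r c)} = {f \<in> ?E. probes (f, g) (c (p' x))}"
        using x Node.prems(3) QueryF by (auto simp: extensions_apply)
      then show "2 ^ (n - 1) * card {f \<in> ?E. probes (f, g) (Node r c)} \<le> 2 * k' * q * card ?E"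
        using Node.IH[of "c (p' x)" k' "insert x S" p'] child[of "p' x"] p' x Node.prems(3,6) fin
        by (simp add: k card_insert_if split: if_splits)
    qed (use Node.prems(6) in simp)
    also have "\<dots> \<le> 2 * k * q * card (extensions n S p)"
      by (simp add: k add_mult_distrib)
    finally show ?thesis .
  next
    case (QueryG z)
    obtain x y u where z: "z = (x, y, u)" by (cases z)
    then have xyu: "x \<in> bits n" "y \<in> bits n" "u \<in> bits n"
      using Node.prems(1) QueryG by auto
    then have gz: "g z \<in> bits (n - 1)" using g z by auto
    have "2 ^ (n - 1) * card {f \<in> extensions n S p. probes (f, g) (Node r c)}
      \<le> (2 * k' * q + q + q) * card (extensions n S p)"
    proof (rule lazy_sample[OF xyu(1) Node.prems(3-5)])
      fix p' assume p': "inj_on p' (insert x S)" "p' ` insert x S \<subseteq> bits (n - 1)"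
      let ?E = "extensions n (insert x S) p'"
      show "2 ^ (n - 1) * card {f \<in> ?E. probes (f, g) (Node r c)} \<le> (2 * k' * q + q) * card ?E"
      proof (rule lazy_sample[OF xyu(2) _ p'])
        fix p'' assume p'': "inj_on p'' (insert y (insert x S))"
          "p'' ` insert y (insert x S) \<subseteq> bits (n - 1)"
        let ?E = "extensions n (insert y (insert x S)) p''"
        have "f x = p'' x \<and> f y = p'' y" if "f \<in> ?E" for f
          using extensions_apply[OF that] xyu Node.prems(3) by auto
        \<comment> \<open>Injectivity of \<open>p''\<close> forces \<open>f x\<close> and
          \<open>f y\<close> to differ if \<open>x\<close> and \<open>y\<close> do, so the root is
          not a probe and the fixed \<open>g\<close> answers it.\<close>
        then have "{f \<in> ?E. probes (f, g) (Node r c)} = {f \<in> ?E. probes (f, g) (c (g z))}"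
          using p''(1) QueryG z by (auto simp: inj_on_def)
        moreover have "card (insert y (insert x S)) + 2 * k' \<le> q"
          using Node.prems(6) fin by (simp add: k card_insert_if)
        ultimately show "2 ^ (n - 1) * card {f \<in> ?E. probes (f, g) (Node r c)}
            \<le> 2 * k' * q * card ?E"
          using Node.IH[of "c (g z)" k' "insert y (insert x S)" p''] child[OF gz] p'' xyu
            Node.prems(3) by simp
      qed (use Node.prems(3,6) fin xyu in \<open>auto simp: k card_insert_if\<close>)
    qed (use Node.prems(6) in simp)
    also have "\<dots> = 2 * k * q * card (extensions n S p)"
      by (simp add: k add_mult_distrib)
    finally show ?thesis .
  qed
qed

section \<open>Averaging over \<open>f\<close>\<close>

lemma card_probes:
  assumes "g \<in> bits n \<times> bits n \<times> bits n \<rightarrow>\<^sub>E bits (n - 1)"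
    and "decision_tree n Out T" "depth n T \<le> d"
  shows "2 ^ (n - 1) * card {f \<in> bits n \<rightarrow>\<^sub>E bits (n - 1). probes (f, g) T}
    \<le> 4 * d\<^sup>2 * card (bits n \<rightarrow>\<^sub>E bits (n - 1))"
  \<comment> \<open>Initially nothing is revealed; with \<open>k = d\<close> and
    \<open>q = 2 * d\<close> the factor \<open>2 * k * q\<close> becomes
    \<open>4 * d\<^sup>2\<close>.\<close>
  using card_probes_extensions[OF assms, of "{}" _ "2 * d"]
  by (simp add: extensions_def power2_eq_square mult.assoc)

text \<open>Double counting of the pairs \<open>(f, w)\<close> for which \<open>T w\<close> probes:
  if at least half of \<open>W\<close> probed for every \<open>f\<close>, these would be at least
  half of all pairs, but \<open>card_probes\<close> and \<open>8 * d\<^sup>2 < 2 ^ (n - 1)\<close>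
  allow fewer.\<close>

lemma ex_few_probes:
  assumes "g \<in> bits n \<times> bits n \<times> bits n \<rightarrow>\<^sub>E bits (n - 1)"
    and "finite W" "W \<noteq> {}"
    and "\<And>w. w \<in> W \<Longrightarrow> decision_tree n Out (T w) \<and> depth n (T w) \<le> d"
    and "8 * d\<^sup>2 < 2 ^ (n - 1)"
  shows "\<exists>f \<in> bits n \<rightarrow>\<^sub>E bits (n - 1). 2 * card {w \<in> W. probes (f, g) (T w)} < card W"
proof (rule ccontr)
  let ?F = "bits n \<rightarrow>\<^sub>E bits (n - 1)"
  let ?B = "2 ^ (n - 1) :: nat"
  assume "\<not> ?thesis"
  then have *: "card W \<le> 2 * card {w \<in> W. probes (f, g) (T w)}" if "f \<in> ?F" for f
    using that by (auto simp: not_less)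
  have fin: "finite ?F" by (simp add: finite_PiE)
  have "card ?F * card W \<le> (\<Sum>f \<in> ?F. 2 * card {w \<in> W. probes (f, g) (T w)})"
    using sum_mono[of ?F "\<lambda>_. card W"] * by simp
  also have "\<dots> = 2 * (\<Sum>w \<in> W. card {f \<in> ?F. probes (f, g) (T w)})"
    unfolding sum_distrib_left[symmetric]
    using sum.swap_restrict[OF fin assms(2), of "\<lambda>_ _. 1 :: nat" "\<lambda>f w. probes (f, g) (T w)"]
    by simp
  finally have "?B * (card ?F * card W)
      \<le> ?B * (2 * (\<Sum>w \<in> W. card {f \<in> ?F. probes (f, g) (T w)}))"
    by (rule mult_le_mono2)
  also have "\<dots> = 2 * (\<Sum>w \<in> W. ?B * card {f \<in> ?F. probes (f, g) (T w)})"
    by (simp add: sum_distrib_left mult.left_commute)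
  also have "\<dots> \<le> 2 * (\<Sum>w \<in> W. 4 * d\<^sup>2 * card ?F)"
    using assms(4) by (intro mult_le_mono2 sum_mono card_probes[OF assms(1)]) auto
  also have "\<dots> = 8 * d\<^sup>2 * (card ?F * card W)" by simp
  finally have "card ?F * card W = 0"
    using assms(5) by (metis mult_le_cancel2 not_le neq0_conv)
  then show False
    using assms(2,3) fin by (auto simp: PiE_eq_empty_iff)
qed

subsection \<open>The adversary\<close>

text \<open>\<open>S\<close> stands for the entries whose answers are pinned. A query pins at most
  one entry, trading a unit of depth for a unit of \<open>card S\<close>. The remaining room
  provides a fresh answer at each node and, through the summand 2, a second value at the
  leaf.\<close>

lemma adversary:
  assumes f: "f \<in> bits n \<rightarrow>\<^sub>E bits (n - 1)"
  shows "decision_tree n Out D \<Longrightarrow> g \<in> bits n \<times> bits n \<times> bits n \<rightarrow>\<^sub>E bits (n - 1) \<Longrightarrow>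
    finite S \<Longrightarrow> inj_on g S \<Longrightarrow> card S + depth n D + 2 \<le> 2 ^ (n - 1) \<Longrightarrow>
    \<exists>g' \<in> bits n \<times> bits n \<times> bits n \<rightarrow>\<^sub>E bits (n - 1).
      (\<forall>z. z \<in> S \<or> \<not> collision_query f (QueryG z) \<longrightarrow> g' z = g z) \<and>
      \<not> nested_collision_solution n (f, g') (run (f, g') D)"
proof (induction D arbitrary: g S)
  case (Leaf s)
  obtain x y u v where s: "s = (x, y, u, v)" by (cases s)
  show ?case
  proof (cases "nested_collision_solution n (f, g) s")
    case True
    then have sol: "x \<in> bits n" "y \<in> bits n" "u \<in> bits n" "v \<in> bits n" "x \<noteq> y" "f x = f y"
      "u \<noteq> v" "g (x, y, u) = g (x, y, v)"
      using s by auto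
    obtain b where b: "b \<in> bits (n - 1)" "b \<noteq> g (x, y, u)"
      using ex_bits_notin[of "{g (x, y, u)}" "n - 1"] Leaf.prems(5) by auto
    \<comment> \<open>As \<open>g\<close> is injective on \<open>S\<close>, one of the two colliding
      entries is not pinned; altering it destroys the solution.\<close>
    have "(x, y, u) \<notin> S \<or> (x, y, v) \<notin> S"
      using inj_onD[OF Leaf.prems(4) sol(8)] sol(7) by auto
    then obtain t where t: "t = u \<or> t = v" "(x, y, t) \<notin> S" by auto
    have "g((x, y, t) := b) \<in> bits n \<times> bits n \<times> bits n \<rightarrow>\<^sub>E bits (n - 1)"
      using Leaf.prems(2) b(1) t(1) sol(1-4) by (auto simp: PiE_iff extensional_def)
    moreover have "\<forall>z. z \<in> S \<or> \<not> collision_query f (QueryG z) \<longrightarrow> (g((x, y, t) := b)) z = g z"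
      using t(2) sol(5,6) by auto
    moreover have "\<not> nested_collision_solution n (f, g((x, y, t) := b)) s"
      using t(1) sol(7,8) b(2) s by auto
    ultimately show ?thesis by (metis run.simps(1))
  next
    case False
    then show ?thesis using Leaf.prems(2) by auto
  qed
next
  case (Node r c)
  have child: "depth n (c a) < depth n (Node r c)" "decision_tree n Out (c a)"
    if "a \<in> bits (n - 1)" for a
    using depth_child_le[OF le_refl that] Node.prems(1) that by (auto simp: Suc_le_eq)
  show ?case
  proof (cases "\<exists>z. r = QueryG z \<and> collision_query f r \<and> z \<notin> S")
    case True
    then obtain z where z: "r = QueryG z" "collision_query f r" "z \<notin> S" by auto
    \<comment> \<open>Avoiding all values on \<open>S\<close> keeps the table injective once
      \<open>z\<close> is pinned.\<close>
    obtain a where a: "a \<in> bits (n - 1)" "a \<notin> g ` S"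
      using ex_bits_notin[of "g ` S" "n - 1"] card_image_le[OF Node.prems(3), of g] Node.prems(3,5)
      by auto
    have "z \<in> bits n \<times> bits n \<times> bits n" using Node.prems(1) z(1) by simp
    then have "g(z := a) \<in> bits n \<times> bits n \<times> bits n \<rightarrow>\<^sub>E bits (n - 1)"
      using Node.prems(2) a(1) by (auto simp: PiE_iff extensional_def)
    moreover have "inj_on (g(z := a)) (insert z S)"
      using Node.prems(4) a(2) z(3) by (auto simp: inj_on_def)
    moreover have "card (insert z S) + depth n (c a) + 2 \<le> 2 ^ (n - 1)"
      using Node.prems(3,5) child(1)[OF a(1)] z(3) by simp
    ultimately obtain g' where g': "g' \<in> bits n \<times> bits n \<times> bits n \<rightarrow>\<^sub>E bits (n - 1)"
      "\<forall>y. y \<in> insert z S \<or> \<not> collision_query f (QueryG y) \<longrightarrow> g' y = (g(z := a)) y"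
      "\<not> nested_collision_solution n (f, g') (run (f, g') (c a))"
      using Node.IH[of "c a" "g(z := a)" "insert z S"] child(2)[OF a(1)] Node.prems(3)
      by blast
    have "g' y = g y" if "y \<in> S \<or> \<not> collision_query f (QueryG y)" for y
      using g'(2)[rule_format, of y] that z by auto
    moreover have "run (f, g') (Node r c) = run (f, g') (c a)"
      using g'(2)[rule_format, of z] z(1) by simp
    ultimately show ?thesis using g'(1,3) by metis
  next
    case False
    \<comment> \<open>The queried entry can no longer change, so every admissible \<open>g'\<close>
      leads to the same child as \<open>g\<close>.\<close>
    have same: "answer (f, g') r = answer (f, g) r"
      if "\<forall>z. z \<in> S \<or> \<not> collision_query f (QueryG z) \<longrightarrow> g' z = g z" for g'
      using that False by (cases r) auto
    have "answer (f, g) r \<in> bits (n - 1)"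
      using Node.prems(1,2) f by (cases r) auto
    note ch = child[OF this]
    have "\<exists>g' \<in> bits n \<times> bits n \<times> bits n \<rightarrow>\<^sub>E bits (n - 1).
      (\<forall>z. z \<in> S \<or> \<not> collision_query f (QueryG z) \<longrightarrow> g' z = g z) \<and>
      \<not> nested_collision_solution n (f, g') (run (f, g') (c (answer (f, g) r)))"
      using Node.prems(5) ch(1)
      by (intro Node.IH[OF _ ch(2) Node.prems(2-4)]) auto
    then show ?thesis using same by (metis run.simps(2))
  qed
qed

section \<open>Pigeonhole on the trees that do not probe\<close>

lemma not_collision_formulation:
  assumes "m \<ge> 1" and large: "8 * d\<^sup>2 + d + 2 \<le> 2 ^ (n - 1)"
  shows "\<not> collision_formulation d m n T D"
proof
  assume form: "collision_formulation d m n T D"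
  define g :: fun_g where
    "g = (\<lambda>z \<in> bits n \<times> bits n \<times> bits n. replicate (n - 1) False)"
  have g: "g \<in> bits n \<times> bits n \<times> bits n \<rightarrow>\<^sub>E bits (n - 1)"
    by (auto simp: g_def bits_def)
  have T: "decision_tree n (bits (m - 1)) (T w) \<and> depth n (T w) \<le> d" if "w \<in> bits m" for w
    using form that by (auto simp: collision_formulation_def)
  \<comment> \<open>\<open>large\<close> supplies two bounds:
    \<open>8 * d\<^sup>2 < 2 ^ (n - 1)\<close> here, and \<open>d + 2 \<le> 2 ^ (n - 1)\<close> for
    the adversary.\<close>
  obtain f where f: "f \<in> bits n \<rightarrow>\<^sub>E bits (n - 1)"
    and few: "2 * card {w \<in> bits m. probes (f, g) (T w)} < 2 ^ m"
    using ex_few_probes[OF g finite_bits bits_nonempty T] large by fastforce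
  define U where "U = {w \<in> bits m. \<not> probes (f, g) (T w)}"
  have run_bits: "run I t \<in> bits (m - 1)"
    if "decision_tree n (bits (m - 1)) t" "I \<in> nested_collision_instances n" for I and t
    using that
  proof (induction t)
    case (Node q c)
    then have "answer I q \<in> bits (n - 1)"
      by (cases I; cases q) (auto simp: nested_collision_instances_def)
    with Node show ?case by auto
  qed simp
  have "card (bits m) = card U + card {w \<in> bits m. probes (f, g) (T w)}"
    unfolding U_def by (subst card_Un_disjoint[symmetric]) (auto intro!: arg_cong[where f = card] simp del: card_bits)
  \<comment> \<open>There are exactly half as many possible outputs as trees.\<close>
  moreover have "(2 :: nat) ^ m = 2 * 2 ^ (m - 1)"
    using assms(1) by (simp add: power_eq_if)
  ultimately have "card (bits (m - 1)) < card U"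
    using few by simp
  moreover have "(\<lambda>w. run (f, g) (T w)) ` U \<subseteq> bits (m - 1)"
    using run_bits T f g by (auto simp: U_def nested_collision_instances_def)
  ultimately have "\<not> inj_on (\<lambda>w. run (f, g) (T w)) U"
    by (metis card_inj_on_le finite_bits not_le)
  then obtain w1 w2 where w: "w1 \<in> U" "w2 \<in> U" "w1 \<noteq> w2" "run (f, g) (T w1) = run (f, g) (T w2)"
    by (auto simp: inj_on_def)
  have w_bits: "w1 \<in> bits m" "w2 \<in> bits m" using w by (auto simp: U_def)
  have D: "decision_tree n (bits n \<times> bits n \<times> bits n \<times> bits n) (D w1 w2)"
    "depth n (D w1 w2) \<le> d"
    using form w_bits w(3) by (auto simp: collision_formulation_def)
  have "card ({} :: (bool list \<times> bool list \<times> bool list) set) + depth n (D w1 w2) + 2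
    \<le> 2 ^ (n - 1)"
    using D(2) large by simp
  then obtain g' where g': "g' \<in> bits n \<times> bits n \<times> bits n \<rightarrow>\<^sub>E bits (n - 1)"
    "\<And>z. \<not> collision_query f (QueryG z) \<Longrightarrow> g' z = g z"
    "\<not> nested_collision_solution n (f, g') (run (f, g') (D w1 w2))"
    using adversary[OF f D(1) g finite.emptyI inj_on_empty] by blast
  \<comment> \<open>The collision of \<open>w1\<close> and \<open>w2\<close> survives the change to
    \<open>g'\<close>, so correctness would make the refuted output of \<open>D w1 w2\<close> a
    solution.\<close>
  have "run (f, g') (T w) = run (f, g) (T w)" if "w \<in> U" for w
    using that g'(2) by (intro run_cong_not_probes) (auto simp: U_def)
  then have "run (f, g') (T w1) = run (f, g') (T w2)"
    using w by simp
  moreover have "(f, g') \<in> nested_collision_instances n"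
    using f g'(1) by (simp add: nested_collision_instances_def)
  ultimately show False
    using form w_bits w(3) g'(3) by (auto simp: collision_formulation_def)
qed

section \<open>Polynomial against exponential growth\<close>

lemma eventually_poly_less_power_two:
  fixes p :: "nat poly"
  shows "eventually (\<lambda>n. poly p n < 2 ^ n) sequentially"
proof -
  \<comment> \<open>The factor \<open>real n ^ k\<close> strengthens the induction:
    \<open>pCons a p\<close> evaluates to \<open>a + n * poly p n\<close>, which raises the exponent
    by one.\<close>
  have "(\<lambda>n. real n ^ k * real (poly p n) / 2 ^ n) \<longlonglongrightarrow> 0" for k
  proof (induction p arbitrary: k)
    case 0
    then show ?case by simp
  next
    case (pCons a p)
    have "(\<lambda>n. real n ^ k / 2 ^ n) \<longlonglongrightarrow> 0"
      by real_asymp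
    from tendsto_add[OF tendsto_mult_left[OF this, of "real a"] pCons.IH[of "Suc k"]]
    show ?case by (simp add: field_simps)
  qed
  from order_tendstoD(2)[OF this[of 0], of 1]
  have "eventually (\<lambda>n. real (poly p n) / 2 ^ n < 1) sequentially"
    by simp
  then show ?thesis
  proof (rule eventually_mono)
    fix n
    assume "real (poly p n) / 2 ^ n < 1"
    then have "real (poly p n) < real (2 ^ n)" by (simp add: divide_simps)
    then show "poly p n < 2 ^ n" by (simp only: of_nat_less_iff)
  qed
qed

theorem theorem7:
  fixes d m :: "nat \<Rightarrow> nat"
  assumes "polynomially_bounded d"
    and "polynomially_bounded m"
    and "\<And>n. n \<ge> 1 \<Longrightarrow> m n \<ge> 1"
  shows "\<exists>n0 \<ge> 1. \<forall>n \<ge> n0. \<not> (\<exists>T D. collision_formulation (d n) (m n) n T D)"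
proof -
  obtain p :: "nat poly" where p: "\<And>n. d n \<le> poly p n"
    using assms(1) by (auto simp: polynomially_bounded_def)
  \<comment> \<open>This polynomial is twice \<open>8 * p\<^sup>2 + p + 2\<close>, to be compared
    with \<open>2 ^ n = 2 * 2 ^ (n - 1)\<close>.\<close>
  obtain n0 where n0: "\<And>n. n \<ge> n0 \<Longrightarrow> poly (smult 16 (p ^ 2) + smult 2 p + [:4:]) n < 2 ^ n"
    using eventually_poly_less_power_two unfolding eventually_sequentially by blast
  \<comment> \<open>The bound 1 keeps \<open>n - 1\<close> from being truncated and ensures
    \<open>m n \<ge> 1\<close>.\<close>
  have "\<not> collision_formulation (d n) (m n) n T D" if n: "n \<ge> max 1 n0" for n T D
  proof (rule not_collision_formulation)
    have "2 * (8 * (d n)\<^sup>2 + d n + 2) \<le> 2 * (8 * (poly p n)\<^sup>2 + poly p n + 2)"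
      using p[of n] by (intro mult_le_mono2 add_mono power_mono) auto
    also have "\<dots> < 2 ^ n"
      using n0[of n] n by simp
    also have "(2 :: nat) ^ n = 2 * 2 ^ (n - 1)"
      using n by (simp add: power_eq_if)
    finally show "8 * (d n)\<^sup>2 + d n + 2 \<le> 2 ^ (n - 1)" by simp
  qed (use assms(3) n in simp)
  then show ?thesis
    by (intro exI[of _ "max 1 n0"]) auto
qed

end
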